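(* Let $p\in[1,\infty)$ with $p\neq 2$ and let $\omega,\Omega:[0,\infty)\to[0,\infty)$ be two functions (moduli) with $\omega(1)>0$. Then for arbitrarily large $n\in\mathbb{N}$ there exists an $n$-point subset $\mathscr{S}_{n,p}$ of the unit ball ${\bf B}_{\ell_p}$ such that the following holds. If $d\in\mathbb{N}$ and $T:\mathrm{span}(\mathscr{S}_{n,p})\to\ell_p^d$ is a linear operator satisfying $$\forall\, x,y\in\mathscr{S}_{n,p},\qquad \omega\big(\|x-y\|_{\ell_p}\big)\leq\|Tx-Ty\|_{\ell_p^d}\leq\Omega\big(\|x-y\|_{\ell_p}\big),$$ then $$d\geq\left(\frac{\omega(1)}{\Omega(1)}\right)^{\frac{2p}{|p-2|}}\cdot\frac{n-1}{2}.$$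
   Context: $\ell_p$ is the real Banach space of $p$-summable sequences, ${\bf B}_{\ell_p}=\{x\in\ell_p:\|x\|_{\ell_p}\leq1\}$ is its closed unit ball, and $\ell_p^d$ denotes $\mathbb{R}^d$ equipped with the norm $\|a\|_{\ell_p^d}=\big(\sum_{i=1}^d|a_i|^p\big)^{1/p}$. "For arbitrarily large $n$" means that for every $N_0\in\mathbb{N}$ there is some $n\geq N_0$ with the stated property. *)

theory Defs
  imports "HOL-Analysis.Analysis" "HOL-Library.Function_Algebras"
begin

(* With this instance the library's span applies to real sequences; addition, subtraction and
   zero of functions come from Function_Algebras. *)
instantiation "fun" :: (type, real_vector) real_vector
begin

definition scaleR_fun :: "real \<Rightarrow> ('a \<Rightarrow> 'b) \<Rightarrow> 'a \<Rightarrow> 'b"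
  where "c *\<^sub>R f = (\<lambda>x. c *\<^sub>R f x)"

instance
  by standard (simp_all add: scaleR_fun_def fun_eq_iff scaleR_add_right scaleR_add_left)

end

lemma scaleR_fun_apply [simp]: "(c *\<^sub>R f) x = c *\<^sub>R f x"
  by (simp add: scaleR_fun_def)

(* Sequences are indexed from 0.  The exponent p is a value, not a type, so the space is a carrier
   set inside the type of all real sequences. *)
definition lp_space :: "real \<Rightarrow> (nat \<Rightarrow> real) set"
  where "lp_space p = {x. summable (\<lambda>i. \<bar>x i\<bar> powr p)}"

(* Meaningful only for members of lp_space p: suminf is unspecified on divergent series. *)
definition lp_norm :: "real \<Rightarrow> (nat \<Rightarrow> real) \<Rightarrow> real"
  where "lp_norm p x = (\<Sum>i. \<bar>x i\<bar> powr p) powr (1 / p)"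

definition lp_unit_ball :: "real \<Rightarrow> (nat \<Rightarrow> real) set"
  where "lp_unit_ball p = {x \<in> lp_space p. lp_norm p x \<le> 1}"

(* R^d for a dimension d that is quantified inside formulas, with coordinates 0, ..., d-1; setting
   the remaining entries to 0 makes the representation of a vector unique. *)
definition euclid_carrier :: "nat \<Rightarrow> (nat \<Rightarrow> real) set"
  where "euclid_carrier d = {a. \<forall>i\<ge>d. a i = 0}"

definition lpd_norm :: "real \<Rightarrow> nat \<Rightarrow> (nat \<Rightarrow> real) \<Rightarrow> real"
  where "lpd_norm p d a = (\<Sum>i<d. \<bar>a i\<bar> powr p) powr (1 / p)"

(* The library's linear concerns total functions; here the domain and codomain are subspaces
   V and W, and the values of T outside V are irrelevant. *)
definition linear_operator_on ::
    "'a::real_vector set \<Rightarrow> 'b::real_vector set \<Rightarrow> ('a \<Rightarrow> 'b) \<Rightarrow> bool"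
  where "linear_operator_on V W T \<longleftrightarrow>
    (\<forall>x\<in>V. T x \<in> W) \<and>
    (\<forall>x\<in>V. \<forall>y\<in>V. T (x + y) = T x + T y) \<and>
    (\<forall>c. \<forall>x\<in>V. T (c *\<^sub>R x) = c *\<^sub>R T x)"

end

theory Submission
  imports Defs
begin

text \<open>
  Let \<open>N = 2 ^ k\<close>. The point set consists of the origin, the basis vectors
  \<open>e\<^sub>i\<close> of \<open>\<real>\<^sup>N\<close>, and the rows \<open>w\<^sub>i\<close> of an orthogonal matrix with entries \<open>\<plusminus>1\<close>,
  scaled by \<open>N powr (- 1 / p)\<close>; these are \<open>2 * N + 1\<close> points, and all but the origin have norm 1.
  Comparing a point with the origin, whose image is 0, shows that every nonzero point has an
  image of norm between \<open>a = \<omega> 1\<close> and \<open>b = \<Omega> 1\<close>.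

  The two families are incompatible in low dimension because the Walsh matrix is \<open>\<surd>N\<close> times an
  isometry in the Euclidean norm, while the scaling \<open>N powr (- 1 / p)\<close> is adapted to the
  \<open>p\<close>-norm. Write \<open>t i l\<close> for the coordinates of \<open>T e\<^sub>i\<close> and \<open>h i l\<close> for those of \<open>T w\<^sub>i\<close>, with
  \<open>w\<^sub>i\<close> not scaled. Plancherel's identity, applied to each coordinate \<open>l\<close> separately, gives
  \<open>\<Sum> h\<^sup>2 = N * \<Sum> t\<^sup>2\<close> over all \<open>N * d\<close> index pairs.

  For \<open>p < 2\<close> the Euclidean norm is at most the \<open>p\<close>-norm, so \<open>\<Sum> t\<^sup>2 \<le> N * b\<^sup>2\<close> and hence
  \<open>\<Sum> h\<^sup>2 \<le> N\<^sup>2 * b\<^sup>2\<close>. On the other hand \<open>\<Sum> \<bar>h\<bar> powr p \<ge> N\<^sup>2 * a powr p\<close>. By the power mean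
  inequality over \<open>N * d\<close> entries, the \<open>p\<close>-sum can be this large beside the square sum only if
  there are enough entries, which is the bound on \<open>d\<close>. For \<open>p > 2\<close> all these inequalities are
  reversed: a lower bound on \<open>\<Sum> h\<^sup>2\<close> meets an upper bound on \<open>\<Sum> \<bar>h\<bar> powr p\<close>. Both cases
  are instances of \<open>dimension_bound_of_power_sums\<close>.
\<close>

section \<open>Power sums\<close>

text \<open>
  Jensen's inequality for the convex function \<open>\<lambda>x. x powr s\<close>. Convexity is used on the open
  half-line only, so the zero terms are dropped first; this shrinks the index set, which is
  harmless since \<open>card I\<close> enters with the nonnegative exponent \<open>s - 1\<close>.
\<close>
lemma power_mean_powr:
  fixes x :: "'a \<Rightarrow> real"
  assumes fin: "finite I" and nn: "\<And>i. i \<in> I \<Longrightarrow> 0 \<le> x i" and s: "1 \<le> s"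
  shows "(\<Sum>i\<in>I. x i) powr s \<le> real (card I) powr (s - 1) * (\<Sum>i\<in>I. x i powr s)"
proof -
  define P where "P = {i\<in>I. 0 < x i}"
  have finP: "finite P" and sub: "P \<subseteq> I" using fin by (auto simp: P_def)
  have out: "x i = 0" if "i \<in> I - P" for i using nn that by (force simp: P_def)
  have sumP: "(\<Sum>i\<in>I. x i) = (\<Sum>i\<in>P. x i)"
    using out by (intro sum.mono_neutral_right) (auto simp: fin sub)
  have sumPs: "(\<Sum>i\<in>I. x i powr s) = (\<Sum>i\<in>P. x i powr s)"
    using out by (intro sum.mono_neutral_right) (auto simp: fin sub)
  show ?thesis
  proof (cases "P = {}")
    case True
    then show ?thesis by (simp add: sumP sumPs)
  next
    case False
    define m where "m = real (card P)"
    have m: "0 < m" using False finP by (simp add: m_def card_gt_0_iff)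
    have X: "0 < (\<Sum>i\<in>P. x i)" using False finP by (intro sum_pos) (auto simp: P_def)
    have "(\<Sum>i\<in>P. (1/m) *\<^sub>R x i) powr s \<le> (\<Sum>i\<in>P. (1/m) * (x i powr s))"
      using finP False m
      by (intro convex_on_sum[OF _ _ powr_convex[OF s]]) (auto simp: P_def m_def)
    then have "((1/m) * (\<Sum>i\<in>P. x i)) powr s \<le> (1/m) * (\<Sum>i\<in>P. x i powr s)"
      by (simp add: sum_distrib_left)
    then have "(\<Sum>i\<in>P. x i) powr s \<le> m powr (s - 1) * (\<Sum>i\<in>P. x i powr s)"
      using m X by (simp add: powr_mult powr_divide powr_diff field_simps)
    also have "\<dots> \<le> real (card I) powr (s - 1) * (\<Sum>i\<in>P. x i powr s)"
      using m s sub fin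
      by (intro mult_right_mono powr_mono2 sum_nonneg) (auto simp: m_def card_mono)
    finally show ?thesis by (simp add: sumP sumPs)
  qed
qed

text \<open>
  Each term is at most the total \<open>X\<close>, so \<open>x i powr s \<le> x i * X powr (s - 1)\<close>; summation gives
  \<open>X powr s\<close>. This is the monotonicity of \<open>p\<close>-norms in \<open>p\<close>, in a form without roots.
\<close>
lemma sum_powr_le_powr_sum:
  fixes x :: "'a \<Rightarrow> real"
  assumes fin: "finite I" and nn: "\<And>i. i \<in> I \<Longrightarrow> 0 \<le> x i" and s: "1 \<le> s"
  shows "(\<Sum>i\<in>I. x i powr s) \<le> (\<Sum>i\<in>I. x i) powr s"
proof -
  define X where "X = (\<Sum>i\<in>I. x i)"
  have X0: "0 \<le> X" unfolding X_def using nn by (rule sum_nonneg)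
  have "x i powr s \<le> x i * X powr (s - 1)" if i: "i \<in> I" for i
  proof (cases "x i = 0")
    case False
    have le: "x i \<le> X" unfolding X_def using fin nn i by (intro member_le_sum) auto
    have "x i powr s = x i * x i powr (s - 1)"
      using False nn[OF i] by (simp add: powr_diff)
    also have "\<dots> \<le> x i * X powr (s - 1)"
      using le nn[OF i] s by (intro mult_left_mono powr_mono2) auto
    finally show ?thesis .
  qed simp
  then have "(\<Sum>i\<in>I. x i powr s) \<le> (\<Sum>i\<in>I. x i * X powr (s - 1))"
    by (rule sum_mono)
  also have "\<dots> = X * X powr (s - 1)"
    by (simp add: X_def sum_distrib_right)
  also have "\<dots> = X powr s"
    using X0 by (cases "X = 0") (simp_all add: powr_diff)
  finally show ?thesis by (simp add: X_def)
qed

section \<open>From energy bounds to a dimension bound\<close>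

text \<open>
  The common core of the cases \<open>p < 2\<close> and \<open>p > 2\<close>. If \<open>N * d\<close> nonnegative entries have a large
  sum but a small sum of \<open>s\<close>-th powers, then the power mean inequality
  \<open>(N\<^sup>2 * A) powr s \<le> (N * d) powr (s - 1) * (N\<^sup>2 * C)\<close> forces \<open>d\<close> to be large. The powers of
  \<open>N\<close> leave the factor \<open>N powr (2 * (s - 1))\<close>, so after taking the root of order \<open>s - 1\<close> the
  bound is linear in \<open>N\<close> whatever \<open>s\<close> is.
\<close>
lemma dimension_bound_of_power_sums:
  fixes F :: "nat \<Rightarrow> nat \<Rightarrow> real"
  assumes s: "1 < s" and A: "0 \<le> A" and C: "0 < C" and N: "0 < N"
    and nn: "\<And>i l. 0 \<le> F i l"
    and lower: "real N * (real N * A) \<le> (\<Sum>i<N. \<Sum>l<d. F i l)"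
    and upper: "(\<Sum>i<N. \<Sum>l<d. F i l powr s) \<le> real N * (real N * C)"
  shows "(A powr s / C) powr (1 / (s - 1)) * real N \<le> real d"
proof -
  let ?M = "real N"
  define X where "X = A powr s / C"
  have M: "0 < ?M" using N by simp
  have X: "0 \<le> X" using C by (simp add: X_def)
  have "?M powr s * (?M powr s * A powr s) = (?M * (?M * A)) powr s"
    using M A by (simp add: powr_mult)
  also have "\<dots> \<le> (\<Sum>i<N. \<Sum>l<d. F i l) powr s"
    using lower A s by (intro powr_mono2) auto
  also have "\<dots> = (\<Sum>z\<in>{..<N}\<times>{..<d}. F (fst z) (snd z)) powr s"
    by (simp add: sum.cartesian_product split_def)
  also have "\<dots> \<le> real (card ({..<N}\<times>{..<d})) powr (s - 1)
      * (\<Sum>z\<in>{..<N}\<times>{..<d}. F (fst z) (snd z) powr s)"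
    using s nn by (intro power_mean_powr) auto
  also have "\<dots> = (?M * real d) powr (s - 1) * (\<Sum>i<N. \<Sum>l<d. F i l powr s)"
    by (simp add: sum.cartesian_product split_def)
  also have "\<dots> \<le> (?M * real d) powr (s - 1) * (?M * (?M * C))"
    using upper by (intro mult_left_mono) auto
  finally have "X * (?M powr (s - 1) * ?M powr (s - 1)) \<le> (?M * real d) powr (s - 1)"
    using M C by (simp add: X_def powr_diff field_simps)
  then have "(X * (?M powr (s - 1) * ?M powr (s - 1))) powr (1 / (s - 1))
      \<le> ((?M * real d) powr (s - 1)) powr (1 / (s - 1))"
    using s X by (intro powr_mono2) auto
  then have "X powr (1 / (s - 1)) * (?M * ?M) \<le> ?M * real d"
    using s X M by (simp add: powr_mult powr_powr)
  then show ?thesis using M by (simp add: X_def mult.left_commute)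
qed

text \<open>
  Here \<open>F = \<bar>h\<bar> powr p\<close> and \<open>s = 2 / p\<close>: the sum of \<open>F\<close> is bounded below by hypothesis, and the
  sum of its \<open>s\<close>-th powers is the energy of \<open>h\<close>, which is bounded above through \<open>t\<close>.
\<close>
lemma dimension_bound_below_2:
  fixes t h :: "nat \<Rightarrow> nat \<Rightarrow> real"
  assumes p: "0 < p" "p < 2" and ab: "0 < a" "0 < b" and N: "0 < N"
    and energy: "(\<Sum>i<N. \<Sum>l<d. (h i l)\<^sup>2) = real N * (\<Sum>i<N. \<Sum>l<d. (t i l)\<^sup>2)"
    and t: "\<And>i. i < N \<Longrightarrow> (\<Sum>l<d. \<bar>t i l\<bar> powr p) \<le> b powr p"
    and h: "\<And>i. i < N \<Longrightarrow> real N * a powr p \<le> (\<Sum>l<d. \<bar>h i l\<bar> powr p)"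
  shows "(a / b) powr (2 * p / (2 - p)) * real N \<le> real d"
proof -
  have sq: "(\<bar>z\<bar> powr p) powr (2 / p) = z\<^sup>2" for z :: real
    using p by (simp add: powr_powr)
  have "(\<Sum>l<d. (t i l)\<^sup>2) \<le> b\<^sup>2" if i: "i < N" for i
  proof -
    have "(\<Sum>l<d. (\<bar>t i l\<bar> powr p) powr (2 / p)) \<le> (\<Sum>l<d. \<bar>t i l\<bar> powr p) powr (2 / p)"
      using p by (intro sum_powr_le_powr_sum) auto
    also have "\<dots> \<le> (b powr p) powr (2 / p)"
      using p t[OF i] by (intro powr_mono2 sum_nonneg) auto
    finally show ?thesis using sq[of b] ab by (simp add: sq)
  qed
  then have "(\<Sum>i<N. \<Sum>l<d. (t i l)\<^sup>2) \<le> real N * b\<^sup>2"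
    using sum_mono[of "{..<N}" "\<lambda>i. \<Sum>l<d. (t i l)\<^sup>2" "\<lambda>_. b\<^sup>2"] by simp
  then have upper: "(\<Sum>i<N. \<Sum>l<d. (\<bar>h i l\<bar> powr p) powr (2 / p)) \<le> real N * (real N * b\<^sup>2)"
    by (simp add: sq energy mult_left_mono)
  have lower: "real N * (real N * a powr p) \<le> (\<Sum>i<N. \<Sum>l<d. \<bar>h i l\<bar> powr p)"
    using sum_mono[of "{..<N}" "\<lambda>_. real N * a powr p", OF h] by simp
  have "((a powr p) powr (2 / p) / b\<^sup>2) powr (1 / (2 / p - 1)) * real N \<le> real d"
    using p ab N lower upper by (intro dimension_bound_of_power_sums) auto
  moreover have "(a powr p) powr (2 / p) / b\<^sup>2 = (a / b) powr 2"
    using sq[of a] ab by (simp add: power_divide)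
  moreover have "2 * (1 / (2 / p - 1)) = 2 * p / (2 - p)"
    using p by (simp add: field_simps)
  ultimately show ?thesis by (simp only: powr_powr)
qed

text \<open>
  The same argument with the exponents 2 and \<open>p\<close> exchanged: \<open>F = h\<^sup>2\<close> and \<open>s = p / 2\<close>, so that
  the energy bounds the sum of \<open>F\<close> from below and the hypothesis on \<open>h\<close> bounds the sum of the
  \<open>s\<close>-th powers from above.
\<close>
lemma dimension_bound_above_2:
  fixes t h :: "nat \<Rightarrow> nat \<Rightarrow> real"
  assumes p: "2 < p" and ab: "0 < a" "0 < b" and N: "0 < N"
    and energy: "(\<Sum>i<N. \<Sum>l<d. (h i l)\<^sup>2) = real N * (\<Sum>i<N. \<Sum>l<d. (t i l)\<^sup>2)"
    and t: "\<And>i. i < N \<Longrightarrow> a powr p \<le> (\<Sum>l<d. \<bar>t i l\<bar> powr p)"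
    and h: "\<And>i. i < N \<Longrightarrow> (\<Sum>l<d. \<bar>h i l\<bar> powr p) \<le> real N * b powr p"
  shows "(a / b) powr (2 * p / (p - 2)) * real N \<le> real d"
proof -
  have pw: "(z\<^sup>2) powr (p / 2) = \<bar>z\<bar> powr p" for z :: real
  proof -
    have "(z\<^sup>2) powr (p / 2) = (\<bar>z\<bar> powr 2) powr (p / 2)" by simp
    then show ?thesis by (simp only: powr_powr) simp
  qed
  have "a\<^sup>2 \<le> (\<Sum>l<d. (t i l)\<^sup>2)" if i: "i < N" for i
  proof -
    have "(a\<^sup>2) powr (p / 2) \<le> (\<Sum>l<d. ((t i l)\<^sup>2) powr (p / 2))"
      using t[OF i] ab by (simp add: pw)
    also have "\<dots> \<le> (\<Sum>l<d. (t i l)\<^sup>2) powr (p / 2)"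
      using p by (intro sum_powr_le_powr_sum) auto
    finally show ?thesis using p
      by (smt (verit) powr_less_mono2 divide_pos_pos sum_nonneg zero_le_power2)
  qed
  then have "real N * a\<^sup>2 \<le> (\<Sum>i<N. \<Sum>l<d. (t i l)\<^sup>2)"
    using sum_mono[of "{..<N}" "\<lambda>_. a\<^sup>2" "\<lambda>i. \<Sum>l<d. (t i l)\<^sup>2"] by simp
  then have lower: "real N * (real N * a\<^sup>2) \<le> (\<Sum>i<N. \<Sum>l<d. (h i l)\<^sup>2)"
    by (simp add: energy mult_left_mono)
  have upper: "(\<Sum>i<N. \<Sum>l<d. ((h i l)\<^sup>2) powr (p / 2)) \<le> real N * (real N * b powr p)"
    using sum_mono[of "{..<N}" "\<lambda>i. \<Sum>l<d. \<bar>h i l\<bar> powr p", OF h] by (simp add: pw)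
  have "((a\<^sup>2) powr (p / 2) / b powr p) powr (1 / (p / 2 - 1)) * real N \<le> real d"
    using p ab N lower upper by (intro dimension_bound_of_power_sums) auto
  moreover have "(a\<^sup>2) powr (p / 2) / b powr p = (a / b) powr p"
    using ab by (simp add: pw powr_divide)
  moreover have "p * (1 / (p / 2 - 1)) = 2 * p / (p - 2)"
    using p by (simp add: field_simps)
  ultimately show ?thesis by (simp only: powr_powr)
qed

section \<open>The Walsh matrix\<close>

text \<open>
  The sign is \<open>-1\<close> to the number of binary positions below \<open>k\<close> where \<open>i\<close> and \<open>j\<close> both have the
  digit 1. For \<open>i, j < 2 ^ k\<close> this is the Sylvester-Hadamard matrix of order \<open>2 ^ k\<close>. Reading the
  digits from the low end turns a sum over a row into a sum over pairs \<open>2 * j, 2 * j + 1\<close>.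
\<close>
primrec walsh :: "nat \<Rightarrow> nat \<Rightarrow> nat \<Rightarrow> real" where
  "walsh 0 i j = 1"
| "walsh (Suc k) i j = (if odd i \<and> odd j then -1 else 1) * walsh k (i div 2) (j div 2)"

lemma abs_walsh [simp]: "\<bar>walsh k i j\<bar> = 1"
  by (induction k arbitrary: i j) (simp_all add: abs_mult)

lemma walsh_nonzero [simp]: "walsh k i j \<noteq> 0"
  using abs_walsh[of k i j] by fastforce

lemma walsh_commute: "walsh k i j = walsh k j i"
  by (induction k arbitrary: i j) (auto simp: conj_commute)

lemma sum_lessThan_double:
  "(\<Sum>j<2 * m. f j) = (\<Sum>j<m. f (2 * j) + f (Suc (2 * j)))" for m :: nat
  by (induction m) (simp_all add: algebra_simps)

text \<open>
  The two columns \<open>2 * j\<close> and \<open>2 * j + 1\<close> carry the same entries up to the sign in the second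
  one. Their contributions cancel when \<open>i\<close> and \<open>i'\<close> differ in the last digit, and otherwise they
  double the sum for the numbers without that digit.
\<close>
lemma walsh_orthogonal:
  assumes "i < 2 ^ k" and "i' < 2 ^ k"
  shows "(\<Sum>j<2 ^ k. walsh k i j * walsh k i' j) = (if i = i' then 2 ^ k else 0)"
  using assms
proof (induction k arbitrary: i i')
  case 0
  then show ?case by simp
next
  case (Suc k)
  define e where "e = (if odd i = odd i' then 2 else 0 :: real)"
  have "(\<Sum>j<2 ^ Suc k. walsh (Suc k) i j * walsh (Suc k) i' j)
      = (\<Sum>j<2 ^ k. e * (walsh k (i div 2) j * walsh k (i' div 2) j))"
    unfolding power_Suc sum_lessThan_double by (intro sum.cong) (auto simp: e_def)
  also have "\<dots> = e * (\<Sum>j<2 ^ k. walsh k (i div 2) j * walsh k (i' div 2) j)"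
    by (simp add: sum_distrib_left)
  also have "\<dots> = e * (if i div 2 = i' div 2 then 2 ^ k else 0)"
    using Suc.prems by (subst Suc.IH) auto
  also have "\<dots> = (if i = i' then 2 ^ Suc k else 0)"
  proof -
    have "i = i' \<longleftrightarrow> i div 2 = i' div 2 \<and> odd i = odd i'"
      by (metis even_iff_mod_2_eq_zero div_mult_mod_eq not_mod_2_eq_0_eq_1)
    then show ?thesis by (auto simp: e_def)
  qed
  finally show ?case .
qed

text \<open>
  The Walsh matrix is symmetric, so its columns are orthogonal as well; expanding the square
  leaves only the diagonal terms.
\<close>
lemma walsh_plancherel:
  "(\<Sum>i<2 ^ k. (\<Sum>j<2 ^ k. walsh k i j * t j)\<^sup>2) = 2 ^ k * (\<Sum>j<2 ^ k. (t j)\<^sup>2)"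
proof -
  let ?I = "{..<2 ^ k :: nat}"
  have "(\<Sum>i\<in>?I. (\<Sum>j\<in>?I. walsh k i j * t j)\<^sup>2)
      = (\<Sum>i\<in>?I. \<Sum>j\<in>?I. \<Sum>j'\<in>?I. (t j * t j') * (walsh k j i * walsh k j' i))"
    by (simp add: power2_eq_square sum_product walsh_commute[of k _ i for i] mult_ac
        cong: sum.cong)
  also have "\<dots> = (\<Sum>j\<in>?I. \<Sum>i\<in>?I. \<Sum>j'\<in>?I. (t j * t j') * (walsh k j i * walsh k j' i))"
    by (rule sum.swap)
  also have "\<dots> = (\<Sum>j\<in>?I. \<Sum>j'\<in>?I. \<Sum>i\<in>?I. (t j * t j') * (walsh k j i * walsh k j' i))"
    by (intro sum.cong refl sum.swap)
  also have "\<dots> = (\<Sum>j\<in>?I. \<Sum>j'\<in>?I. (t j * t j') * (if j = j' then 2 ^ k else 0))"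
    by (intro sum.cong refl) (simp add: sum_distrib_left[symmetric] walsh_orthogonal)
  also have "\<dots> = (\<Sum>j\<in>?I. t j * t j * 2 ^ k)"
    by (intro sum.cong refl) (simp add: if_distrib cong: if_cong)
  finally show ?thesis
    by (simp add: power2_eq_square sum_distrib_left mult_ac)
qed

section \<open>The point set\<close>

lemma lp_norm_finite_support:
  assumes "\<And>i. i \<ge> N \<Longrightarrow> x i = 0"
  shows "x \<in> lp_space p" and "lp_norm p x = (\<Sum>i<N. \<bar>x i\<bar> powr p) powr (1 / p)"
proof -
  have "\<bar>x i\<bar> powr p = 0" if "i \<notin> {..<N}" for i using assms that by simp
  then show "x \<in> lp_space p" and "lp_norm p x = (\<Sum>i<N. \<bar>x i\<bar> powr p) powr (1 / p)"
    unfolding lp_space_def lp_norm_def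
    using summable_finite[of "{..<N}" "\<lambda>i. \<bar>x i\<bar> powr p"]
      suminf_finite[of "{..<N}" "\<lambda>i. \<bar>x i\<bar> powr p"] by auto
qed

definition unit_seq :: "nat \<Rightarrow> nat \<Rightarrow> real" where
  "unit_seq i = (\<lambda>j. if j = i then 1 else 0)"

text \<open>
  All \<open>2 ^ k\<close> entries of a Walsh row have absolute value 1; the factor brings its \<open>p\<close>-norm to 1.
\<close>
definition walsh_seq :: "real \<Rightarrow> nat \<Rightarrow> nat \<Rightarrow> nat \<Rightarrow> real" where
  "walsh_seq p k i = (\<lambda>j. if j < 2 ^ k then (2 ^ k) powr (- 1 / p) * walsh k i j else 0)"

definition walsh_points :: "real \<Rightarrow> nat \<Rightarrow> (nat \<Rightarrow> real) set" where
  "walsh_points p k = insert 0 (unit_seq ` {..<2 ^ k} \<union> walsh_seq p k ` {..<2 ^ k})"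

lemma unit_seq_nonzero: "unit_seq i \<noteq> 0"
  by (metis unit_seq_def zero_fun_apply zero_neq_one)

lemma walsh_seq_nonzero: "walsh_seq p k i \<noteq> 0"
proof
  assume "walsh_seq p k i = 0"
  from fun_cong[OF this, of 0] show False by (simp add: walsh_seq_def)
qed

lemma unit_seq_normalised:
  assumes "0 < p"
  shows "unit_seq i \<in> lp_space p" and "lp_norm p (unit_seq i) = 1"
proof -
  have z: "unit_seq i j = 0" if "j \<ge> Suc i" for j using that by (simp add: unit_seq_def)
  have "(\<Sum>j<Suc i. \<bar>unit_seq i j\<bar> powr p) = 1"
    using assms by (simp add: unit_seq_def)
  then show "unit_seq i \<in> lp_space p" and "lp_norm p (unit_seq i) = 1"
    using lp_norm_finite_support[OF z] by simp_all
qed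

lemma walsh_seq_normalised:
  assumes "0 < p"
  shows "walsh_seq p k i \<in> lp_space p" and "lp_norm p (walsh_seq p k i) = 1"
proof -
  have z: "walsh_seq p k i j = 0" if "j \<ge> 2 ^ k" for j using that by (simp add: walsh_seq_def)
  have "(\<Sum>j<2 ^ k. \<bar>walsh_seq p k i j\<bar> powr p) = (\<Sum>j<2 ^ k::nat. ((2 ^ k) powr (- 1 / p)) powr p)"
    by (intro sum.cong) (simp_all add: walsh_seq_def abs_mult)
  also have "\<dots> = 1"
    using assms by (simp add: powr_powr powr_neg_one)
  finally show "walsh_seq p k i \<in> lp_space p" and "lp_norm p (walsh_seq p k i) = 1"
    using lp_norm_finite_support[OF z] by simp_all
qed

lemma inj_walsh_seq: "inj_on (walsh_seq p k) {..<2 ^ k}"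
proof (rule inj_onI)
  fix i i' :: nat
  assume i: "i \<in> {..<2 ^ k}" and i': "i' \<in> {..<2 ^ k}" and eq: "walsh_seq p k i = walsh_seq p k i'"
  have "walsh k i j = walsh k i' j" if "j < 2 ^ k" for j
    using fun_cong[OF eq, of j] that by (simp add: walsh_seq_def)
  then have "(\<Sum>j<2 ^ k. walsh k i j * walsh k i' j) = (\<Sum>j<2 ^ k. walsh k i j * walsh k i j)"
    by (intro sum.cong) auto
  then show "i = i'"
    using i i' by (auto simp: walsh_orthogonal split: if_splits)
qed

text \<open>
  The hypothesis \<open>1 \<le> k\<close> gives the Walsh rows at least two nonzero entries, which separates them
  from the basis vectors; for \<open>k = 0\<close> the two families coincide.
\<close>
lemma card_walsh_points:
  assumes "1 \<le> k"
  shows "finite (walsh_points p k)" and "card (walsh_points p k) = 2 * 2 ^ k + 1"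
proof -
  show "finite (walsh_points p k)" by (simp add: walsh_points_def)
  have two: "(2::nat) \<le> 2 ^ k" using assms by (metis power_increasing power_one_right one_le_numeral)
  have inj: "inj_on unit_seq {..<2 ^ k}"
    by (rule inj_onI) (metis unit_seq_def zero_neq_one)
  have ne: "unit_seq i \<noteq> walsh_seq p k i'" for i i'
  proof
    assume eq: "unit_seq i = walsh_seq p k i'"
    define j where "j = (if i = 0 then 1 else 0 :: nat)"
    have "j < 2 ^ k" "j \<noteq> i" using two by (auto simp: j_def)
    then show False using fun_cong[OF eq, of j] by (simp add: unit_seq_def walsh_seq_def)
  qed
  have zero: "0 \<notin> unit_seq ` {..<2 ^ k} \<union> walsh_seq p k ` {..<2 ^ k}"
    using unit_seq_nonzero walsh_seq_nonzero by (metis Un_iff imageE)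
  have "card (unit_seq ` {..<2 ^ k} \<union> walsh_seq p k ` {..<2 ^ k}) = 2 ^ k + 2 ^ k"
    using ne by (subst card_Un_disjoint) (auto simp: card_image inj inj_walsh_seq)
  then show "card (walsh_points p k) = 2 * 2 ^ k + 1"
    using zero by (simp add: walsh_points_def)
qed

section \<open>Linear operators on the point set\<close>

lemma sum_fun_apply: "(\<Sum>i\<in>I. f i) x = (\<Sum>i\<in>I. f i x)"
  by (induction I rule: infinite_finite_induct) auto

lemma linear_operator_on_zero:
  assumes "linear_operator_on V W T" and "subspace V"
  shows "T 0 = 0"
  using assms unfolding linear_operator_on_def
  by (metis scale_zero_left subspace_0)

lemma linear_operator_on_sum:
  assumes "linear_operator_on V W T" and "subspace V" and "finite I"
    and "\<And>i. i \<in> I \<Longrightarrow> v i \<in> V"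
  shows "T (\<Sum>i\<in>I. c i *\<^sub>R v i) = (\<Sum>i\<in>I. c i *\<^sub>R T (v i))"
  using assms(3,4)
proof (induction I rule: finite_induct)
  case empty
  then show ?case using linear_operator_on_zero[OF assms(1,2)] by simp
next
  case (insert i I)
  have "c i *\<^sub>R v i \<in> V" "(\<Sum>i\<in>I. c i *\<^sub>R v i) \<in> V"
    using assms(2) insert by (auto intro!: subspace_sum subspace_scale)
  then show ?case
    using insert assms(1) unfolding linear_operator_on_def by simp
qed

lemma walsh_seq_eq_sum:
  "walsh_seq p k i = (\<Sum>j<2 ^ k. ((2 ^ k) powr (- 1 / p) * walsh k i j) *\<^sub>R unit_seq j)"
  by (rule ext) (simp add: walsh_seq_def unit_seq_def sum_fun_apply if_distrib cong: if_cong)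

lemma lpd_norm_powr:
  assumes "p \<noteq> 0"
  shows "lpd_norm p d a powr p = (\<Sum>l<d. \<bar>a l\<bar> powr p)"
  using assms by (simp add: lpd_norm_def powr_powr sum_nonneg)

text \<open>
  Linearity expresses the images of the scaled Walsh rows as \<open>N powr (- 1 / p)\<close> times the Walsh
  transform \<open>h\<close> of the images \<open>t\<close> of the basis vectors, coordinate by coordinate. Undoing the
  scaling is what produces the factor \<open>N\<close> in the bounds on \<open>h\<close>, to be played off against the
  factor \<open>N\<close> in Plancherel's identity.
\<close>
lemma walsh_points_dimension_bound:
  assumes p: "1 \<le> p" "p \<noteq> 2" and a: "0 < a"
    and T: "linear_operator_on (span (walsh_points p k)) W T"
    and bounds: "\<And>x. x \<in> walsh_points p k - {0} \<Longrightarrow>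
      a \<le> lpd_norm p d (T x) \<and> lpd_norm p d (T x) \<le> b"
    and k: "1 \<le> k"
  shows "(a / b) powr (2 * p / \<bar>p - 2\<bar>) * 2 ^ k \<le> real d"
proof -
  define N :: nat where "N = 2 ^ k"
  define t where "t = (\<lambda>i. T (unit_seq i))"
  define h where "h = (\<lambda>i l. \<Sum>j<N. walsh k i j * t j l)"
  have N: "0 < N" "real N = 2 ^ k" by (simp_all add: N_def)
  have unit: "unit_seq i \<in> walsh_points p k - {0}"
    and row: "walsh_seq p k i \<in> walsh_points p k - {0}" if "i < N" for i
    using that by (auto simp: walsh_points_def N_def unit_seq_nonzero walsh_seq_nonzero)
  have Trow: "T (walsh_seq p k i) l = real N powr (- 1 / p) * h i l" for i l
  proof -
    have "T (\<Sum>j<N. (real N powr (- 1 / p) * walsh k i j) *\<^sub>R unit_seq j)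
        = (\<Sum>j<N. (real N powr (- 1 / p) * walsh k i j) *\<^sub>R T (unit_seq j))"
      using unit by (intro linear_operator_on_sum[OF T]) (auto intro: span_base)
    then have "T (walsh_seq p k i) = (\<Sum>j<N. (real N powr (- 1 / p) * walsh k i j) *\<^sub>R t j)"
      by (simp add: walsh_seq_eq_sum t_def N_def)
    then show ?thesis
      by (simp add: sum_fun_apply h_def sum_distrib_left mult_ac)
  qed
  have ab: "a powr p \<le> (\<Sum>l<d. \<bar>T x l\<bar> powr p) \<and> (\<Sum>l<d. \<bar>T x l\<bar> powr p) \<le> b powr p"
    if "x \<in> walsh_points p k - {0}" for x
  proof -
    have "a powr p \<le> lpd_norm p d (T x) powr p" and "lpd_norm p d (T x) powr p \<le> b powr p"
      using bounds[OF that] a p by (auto intro!: powr_mono2)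
    then show ?thesis using p by (simp add: lpd_norm_powr)
  qed
  have b: "0 < b" using bounds[OF unit[OF N(1)]] a by linarith
  have t: "a powr p \<le> (\<Sum>l<d. \<bar>t i l\<bar> powr p)" "(\<Sum>l<d. \<bar>t i l\<bar> powr p) \<le> b powr p"
    if "i < N" for i
    using ab[OF unit[OF that]] by (simp_all add: t_def)
  have h: "real N * a powr p \<le> (\<Sum>l<d. \<bar>h i l\<bar> powr p)"
    "(\<Sum>l<d. \<bar>h i l\<bar> powr p) \<le> real N * b powr p" if "i < N" for i
  proof -
    have "(real N powr (- 1 / p)) powr p = 1 / real N"
      using p N(1) by (simp add: powr_powr powr_neg_one)
    then have "(\<Sum>l<d. \<bar>h i l\<bar> powr p) = real N * (\<Sum>l<d. \<bar>T (walsh_seq p k i) l\<bar> powr p)"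
      using N(1) by (simp add: Trow abs_mult powr_mult sum_distrib_left)
    then show "real N * a powr p \<le> (\<Sum>l<d. \<bar>h i l\<bar> powr p)"
      and "(\<Sum>l<d. \<bar>h i l\<bar> powr p) \<le> real N * b powr p"
      using ab[OF row[OF that]] by (simp_all add: mult_left_mono)
  qed
  have "(\<Sum>i<N. \<Sum>l<d. (h i l)\<^sup>2) = (\<Sum>l<d. \<Sum>i<N. (h i l)\<^sup>2)" by (rule sum.swap)
  also have "\<dots> = (\<Sum>l<d. real N * (\<Sum>i<N. (t i l)\<^sup>2))"
    by (simp add: h_def N_def walsh_plancherel)
  also have "\<dots> = real N * (\<Sum>i<N. \<Sum>l<d. (t i l)\<^sup>2)"
    by (simp add: sum_distrib_left[symmetric] sum.swap[of _ "{..<d}"])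
  finally have energy: "(\<Sum>i<N. \<Sum>l<d. (h i l)\<^sup>2) = real N * (\<Sum>i<N. \<Sum>l<d. (t i l)\<^sup>2)" .
  show ?thesis
  proof (cases "p < 2")
    case True
    then show ?thesis
      using dimension_bound_below_2[OF _ True a b N(1) energy t(2) h(1)] p N(2) by simp
  next
    case False
    then have "2 < p" using p by simp
    then show ?thesis
      using dimension_bound_above_2[OF _ a b N(1) energy t(1) h(2)] N(2) by simp
  qed
qed

section \<open>Large point sets without linear dimension reduction\<close>

theorem theorem6:
  fixes p :: real and \<omega> \<Omega> :: "real \<Rightarrow> real"
  assumes "1 \<le> p" and "p \<noteq> 2"
    and "\<And>t. 0 \<le> t \<Longrightarrow> 0 \<le> \<omega> t"
    and "\<And>t. 0 \<le> t \<Longrightarrow> 0 \<le> \<Omega> t"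
    and "0 < \<omega> 1"
  shows "\<forall>N0::nat. \<exists>n\<ge>N0. \<exists>S. S \<subseteq> lp_unit_ball p \<and> finite S \<and> card S = n \<and>
    (\<forall>(d::nat) (T :: (nat \<Rightarrow> real) \<Rightarrow> (nat \<Rightarrow> real)).
      linear_operator_on (span S) (euclid_carrier d) T \<longrightarrow>
      (\<forall>x\<in>S. \<forall>y\<in>S. \<omega> (lp_norm p (x - y)) \<le> lpd_norm p d (T x - T y) \<and>
                    lpd_norm p d (T x - T y) \<le> \<Omega> (lp_norm p (x - y))) \<longrightarrow>
      real d \<ge> (\<omega> 1 / \<Omega> 1) powr (2 * p / \<bar>p - 2\<bar>) * ((real n - 1) / 2))"
proof
  fix N0 :: nat
  (* This k makes 2 ^ k exceed N0 and is positive, as the count of the points requires. *)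
  define k where "k = Suc N0"
  define S where "S = walsh_points p k"
  have k: "1 \<le> k" by (simp add: k_def)
  have norm: "x \<in> lp_space p \<and> lp_norm p x = 1" if "x \<in> S - {0}" for x
    using that assms(1) unit_seq_normalised[of p] walsh_seq_normalised[of p]
    by (auto simp: S_def walsh_points_def)
  have "0 \<in> lp_unit_ball p"
    using lp_norm_finite_support[of 0 0 p] by (simp add: lp_unit_ball_def)
  then have ball: "S \<subseteq> lp_unit_ball p"
    using norm by (force simp: lp_unit_ball_def)
  have zero: "0 \<in> S" by (simp add: S_def walsh_points_def)
  have dim: "real d \<ge> (\<omega> 1 / \<Omega> 1) powr (2 * p / \<bar>p - 2\<bar>) * ((real (2 * 2 ^ k + 1) - 1) / 2)"
    if T: "linear_operator_on (span S) (euclid_carrier d) T"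
      and bounds: "\<forall>x\<in>S. \<forall>y\<in>S. \<omega> (lp_norm p (x - y)) \<le> lpd_norm p d (T x - T y) \<and>
                    lpd_norm p d (T x - T y) \<le> \<Omega> (lp_norm p (x - y))"
    for d and T :: "(nat \<Rightarrow> real) \<Rightarrow> (nat \<Rightarrow> real)"
  proof -
    have "T 0 = 0" using linear_operator_on_zero[OF T] by simp
    then have "\<omega> 1 \<le> lpd_norm p d (T x) \<and> lpd_norm p d (T x) \<le> \<Omega> 1" if "x \<in> S - {0}" for x
      using bounds[rule_format, of x 0] zero norm[OF that] that by simp
    then show ?thesis
      using walsh_points_dimension_bound[OF assms(1,2,5) T[unfolded S_def] _ k, of d "\<Omega> 1"]
      by (simp add: S_def)
  qed
  have "N0 \<le> 2 * 2 ^ k + 1"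
    using less_exp[of k] by (simp add: k_def)
  then show "\<exists>n\<ge>N0. \<exists>S. S \<subseteq> lp_unit_ball p \<and> finite S \<and> card S = n \<and>
    (\<forall>(d::nat) (T :: (nat \<Rightarrow> real) \<Rightarrow> (nat \<Rightarrow> real)).
      linear_operator_on (span S) (euclid_carrier d) T \<longrightarrow>
      (\<forall>x\<in>S. \<forall>y\<in>S. \<omega> (lp_norm p (x - y)) \<le> lpd_norm p d (T x - T y) \<and>
                    lpd_norm p d (T x - T y) \<le> \<Omega> (lp_norm p (x - y))) \<longrightarrow>
      real d \<ge> (\<omega> 1 / \<Omega> 1) powr (2 * p / \<bar>p - 2\<bar>) * ((real n - 1) / 2))"
    using ball card_walsh_points[OF k, of p] dim
    by (intro exI[of _ "2 * 2 ^ k + 1"] conjI exI[of _ S]) (auto simp: S_def)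
qed

end
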